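(* For an abelian group $G$, the following conditions are equivalent: (i) $G$ has a faithful unitary character, i.e., $G$ is isomorphic to a subgroup of $\mathbf T$. (ii) The cardinality of $G$ is at most $\mathfrak c$, and there is no prime $p$ for which $G$ has a subgroup isomorphic to $C_p \times C_p$.
   Context: $\mathbf T$ is the multiplicative group of complex numbers of modulus one (with $G$ and $\mathbf T$ regarded as abstract groups), $\mathfrak c$ is the cardinality of the continuum, and $C_p$ is the cyclic group of order $p$. A unitary character of $G$ is a homomorphism $G \to \mathbf T$. *)

theory Defs
  imports
    Complex_Main
    "HOL-Library.Equipollence"
    "HOL-Computational_Algebra.Primes"
    "HOL-Algebra.Elementary_Groups"
begin

definition circle_group :: "complex monoid" where
  "circle_group = \<lparr>carrier = {z. cmod z = 1}, mult = (*), one = 1\<rparr>"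

definition unitary_character :: "('a, 'b) monoid_scheme \<Rightarrow> ('a \<Rightarrow> complex) \<Rightarrow> bool" where
  "unitary_character G \<chi> \<longleftrightarrow> \<chi> \<in> hom G circle_group"

(* Only the values on carrier G matter: chi is a total HOL function,
   arbitrary outside the carrier. *)
definition faithful_unitary_character :: "('a, 'b) monoid_scheme \<Rightarrow> ('a \<Rightarrow> complex) \<Rightarrow> bool" where
  "faithful_unitary_character G \<chi> \<longleftrightarrow> unitary_character G \<chi> \<and> inj_on \<chi> (carrier G)"

definition has_subgroup_iso_to :: "('a, 'b) monoid_scheme \<Rightarrow> ('c, 'd) monoid_scheme \<Rightarrow> bool" where
  "has_subgroup_iso_to G K \<longleftrightarrow> (\<exists>H. subgroup H G \<and> G\<lparr>carrier := H\<rparr> \<cong> K)"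

end

(* Zorn's lemma is applied to partial embeddings, i.e. graphs R <= G x T of isomorphisms between
   subgroups. Fix an injection j of G into a Hamel basis of the reals over Q that contains 1, avoiding 1
   itself, and require the values of R to lie in the image under s |-> exp (2 pi i s) of the rational
   span of 1 and j(domain of R). Given x outside the domain D of R:
   - if no positive power of x lies in D, send x to exp (2 pi i j(x));
   - otherwise some power z of x lies outside D while z^p lies in D for a prime p, and some p-th
     root of the image of z^p is not yet a value, since G has at most p elements killed by p.
   Hence a maximal R is defined on all of G. *)
theory Submission
  imports Defs "HOL-Analysis.Continuum_Not_Denumerable"
begin

section \<open>Powers in groups, torsion, and copies of C_p x C_p\<close>

text \<open>Bezout: if \<open>m * a + n * b = 1\<close>, then \<open>x\<close> is a product of
  powers of the two given elements. It is applied with a prime \<open>p\<close> and an exponent that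
  \<open>p\<close> does not divide.\<close>

lemma (in group) mem_subgroup_if_coprime_pows:
  fixes m n :: int
  assumes H: "subgroup H G" and x: "x \<in> carrier G"
    and "x [^] m \<in> H" "x [^] n \<in> H" "coprime m n"
  shows "x \<in> H"
proof -
  obtain a b where ab: "m * a + n * b = 1"
    using bezout_int[of m n] \<open>coprime m n\<close> by (metis coprime_iff_gcd_eq_1 mult.commute)
  have "x = (x [^] m) [^] a \<otimes> (x [^] n) [^] b"
    using x ab by (simp add: int_pow_pow flip: int_pow_mult)
  then show ?thesis
    using assms subgroup_int_pow_closed[OF H] subgroup.m_closed[OF H] by metis
qed

lemma (in group) int_pow_mod:
  assumes "x \<in> carrier G" "x [^] (n::int) = \<one>"
  shows "x [^] (k mod n) = x [^] k"
proof -
  have "x [^] k = x [^] (n * (k div n) + k mod n)" by simp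
  also have "\<dots> = (x [^] n) [^] (k div n) \<otimes> x [^] (k mod n)"
    using assms(1) by (simp only: int_pow_mult int_pow_pow)
  finally show ?thesis using assms by simp
qed

lemma (in group_hom) has_subgroup_iso_toI:
  assumes "inj_on h (carrier G)"
  shows "has_subgroup_iso_to H G"
proof -
  have "h \<in> iso G (H\<lparr>carrier := h ` carrier G\<rparr>)"
    using assms by (auto simp: iso_def hom_def bij_betw_def)
  then have "H\<lparr>carrier := h ` carrier G\<rparr> \<cong> G"
    using G.iso_sym is_isoI by blast
  then show ?thesis
    using img_is_subgroup unfolding has_subgroup_iso_to_def by blast
qed

lemma has_subgroup_iso_toD:
  assumes "group G" "has_subgroup_iso_to G K"
  obtains h where "h \<in> hom K G" "inj_on h (carrier K)"
proof -
  obtain H f where H: "subgroup H G" and f: "f \<in> iso (G\<lparr>carrier := H\<rparr>) K"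
    using assms(2) by (auto simp: has_subgroup_iso_to_def is_iso_def)
  have gH: "group (G\<lparr>carrier := H\<rparr>)"
    using H assms(1) subgroup.subgroup_is_group by blast
  then obtain h where h: "h \<in> iso K (G\<lparr>carrier := H\<rparr>)"
    using group.iso_set_sym[OF gH f] by blast
  then have "h \<in> hom K G"
    using subgroup.subset[OF H] by (fastforce simp: iso_def hom_def)
  moreover have "inj_on h (carrier K)"
    using h by (simp add: iso_def bij_betw_def)
  ultimately show ?thesis by (rule that)
qed

text \<open>The map sending (i, j) to a^i b^j respects addition modulo \<open>p\<close> because both
  elements are killed by \<open>p\<close>. Its kernel is trivial because \<open>p\<close> is prime:
  a further element would put \<open>b\<close> among the powers of \<open>a\<close>, or make
  \<open>a\<close> trivial.\<close>

lemma (in comm_group) has_subgroup_iso_to_square_of_cyclicI: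
  assumes p: "prime p" and a: "a \<in> carrier G" "a [^] int p = \<one>" "a \<noteq> \<one>"
    and b: "b \<in> carrier G" "b [^] int p = \<one>" "b \<notin> range (\<lambda>n::int. a [^] n)"
  shows "has_subgroup_iso_to G (integer_mod_group p \<times>\<times> integer_mod_group p)"
proof -
  let ?C = "integer_mod_group p" and ?h = "\<lambda>(i, j). a [^] (i::int) \<otimes> b [^] (j::int)"
  have p0: "p > 0" using p prime_gt_0_nat by blast
  have hom: "?h \<in> hom (?C \<times>\<times> ?C) G"
  proof (rule homI, goal_cases)
    case (1 x) then show ?case using a b by auto
  next
    case (2 x y)
    obtain i j k l where "x = (i, j)" "y = (k, l)" by fastforce
    then show ?case
      using a b by (simp add: int_pow_mod int_pow_mult m_ac)
  qed
  interpret h: group_hom "?C \<times>\<times> ?C" G ?h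
    using hom by (simp add: group_hom_def group_hom_axioms_def DirProd_group is_group)
  have cop: "coprime (int p) i" if "i \<in> carrier ?C" "i \<noteq> 0" for i
  proof -
    have "\<not> int p dvd i"
      using that p0 zdvd_not_zless[of i "int p"] by (auto simp: carrier_integer_mod_group)
    then show ?thesis using p by (simp add: prime_imp_coprime)
  qed
  have "x = \<one>\<^bsub>?C \<times>\<times> ?C\<^esub>" if x: "x \<in> carrier (?C \<times>\<times> ?C)" and "?h x = \<one>" for x
  proof -
    obtain i j where ij: "x = (i, j)" "i \<in> carrier ?C" "j \<in> carrier ?C" using x by auto
    have eq: "a [^] i \<otimes> b [^] j = \<one>" using \<open>?h x = \<one>\<close> ij by simp
    have A: "subgroup (range (\<lambda>n::int. a [^] n)) G" by (rule subgroup_of_powers[OF a(1)])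
    \<comment> \<open>The kernel equation puts b^j among the powers of \<open>a\<close>, where b^p =
      1 lies as well. If \<open>j\<close> were nonzero, hence coprime to \<open>p\<close>, then
      \<open>b\<close> itself would be such a power.\<close>
    have "b [^] j = inv (a [^] i)"
      using eq a b by (metis inv_equality int_pow_closed inv_inv)
    then have "b [^] j \<in> range (\<lambda>n::int. a [^] n)"
      using a(1) by (metis int_pow_neg rangeI)
    moreover have "b [^] int p \<in> range (\<lambda>n::int. a [^] n)"
      using b(2) subgroup.one_closed[OF A] by simp
    ultimately have j: "j = 0"
      using mem_subgroup_if_coprime_pows[OF A b(1)] cop[OF ij(3)] b(3) by blast
    \<comment> \<open>The same argument with the trivial subgroup in place of the powers of
      \<open>a\<close>.\<close>
    then have "a [^] i \<in> {\<one>}" "a [^] int p \<in> {\<one>}" using eq a by auto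
    then have "i = 0"
      using mem_subgroup_if_coprime_pows[OF triv_subgroup a(1)] cop[OF ij(2)] a(3) by blast
    with j ij show ?thesis by simp
  qed
  then have "inj_on ?h (carrier (?C \<times>\<times> ?C))"
    using h.inj_on_one_iff by blast
  then show ?thesis by (rule h.has_subgroup_iso_toI)
qed

text \<open>Fix a nontrivial \<open>a\<close> in \<open>S\<close>. An element of \<open>S\<close>
  that is not a power of \<open>a\<close> would generate a copy of C_p x C_p together with
  \<open>a\<close>, so \<open>S\<close> consists of powers of \<open>a\<close>, and exponents matter
  only modulo \<open>p\<close>.\<close>

lemma (in comm_group) card_torsion_le:
  assumes p: "prime p"
    and no: "\<not> has_subgroup_iso_to G (integer_mod_group p \<times>\<times> integer_mod_group p)"
    and S: "S \<subseteq> {x \<in> carrier G. x [^] p = \<one>}"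
  shows "card S \<le> p"
proof (cases "S \<subseteq> {\<one>}")
  case True
  then have "card S \<le> card {\<one>}" by (intro card_mono) auto
  then show ?thesis using prime_ge_1_nat[OF p] by simp
next
  case False
  then obtain a where a: "a \<in> S" "a \<noteq> \<one>" by blast
  have p0: "p > 0" using p prime_gt_0_nat by blast
  have "S \<subseteq> (\<lambda>n::nat. a [^] n) ` {..<p}"
  proof
    fix b assume "b \<in> S"
    then have "b \<in> range (\<lambda>n::int. a [^] n)"
      using has_subgroup_iso_to_square_of_cyclicI[OF p, of a b] no a S
      by (auto simp: int_pow_int)
    then obtain n :: int where n: "b = a [^] n" by blast
    have "a [^] n = a [^] (n mod int p)"
      using a S by (subst int_pow_mod) (auto simp: int_pow_int)
    also have "\<dots> = a [^] nat (n mod int p)"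
      using p0 by (simp flip: int_pow_int)
    finally show "b \<in> (\<lambda>n::nat. a [^] n) ` {..<p}"
      using n p0 by (auto intro!: image_eqI[of _ _ "nat (n mod int p)"] simp: nat_less_iff)
  qed
  then show ?thesis
    using surj_card_le[of "{..<p}" S] by simp
qed

section \<open>The circle group\<close>

lemma comm_group_circle_group: "comm_group circle_group"
proof (rule comm_groupI)
  fix x assume x: "x \<in> carrier circle_group"
  then have "x \<noteq> 0" by (auto simp: circle_group_def)
  with x show "\<exists>y\<in>carrier circle_group. y \<otimes>\<^bsub>circle_group\<^esub> x = \<one>\<^bsub>circle_group\<^esub>"
    by (intro bexI[of _ "inverse x"]) (auto simp: circle_group_def norm_inverse)
qed (auto simp: circle_group_def norm_mult)

interpretation circle: comm_group circle_group
  by (rule comm_group_circle_group)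

lemma circle_group_simps [simp]:
  "z \<in> carrier circle_group \<longleftrightarrow> cmod z = 1"
  "z \<otimes>\<^bsub>circle_group\<^esub> w = z * w"
  "\<one>\<^bsub>circle_group\<^esub> = 1"
  by (simp_all add: circle_group_def)

lemma pow_circle_group [simp]: "z [^]\<^bsub>circle_group\<^esub> (n::nat) = z ^ n"
  by (induction n) (simp_all add: nat_pow_def circle_group_def)

lemma inv_circle_group [simp]:
  assumes "cmod z = 1"
  shows "inv\<^bsub>circle_group\<^esub> z = inverse z"
proof -
  have "z \<noteq> 0" using assms by auto
  with assms show ?thesis by (intro circle.inv_equality) (auto simp: norm_inverse)
qed

lemma circle_group_lepoll_real: "carrier circle_group \<lesssim> (UNIV :: real set)"
proof -
  have "cis (Arg z) = z" if "z \<in> carrier circle_group" for z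
    using that cis_Arg[of z] by (cases "z = 0") (auto simp: sgn_eq)
  then have "inj_on Arg (carrier circle_group)" by (metis inj_onI)
  then show ?thesis by (auto simp: lepoll_def)
qed

text \<open>All p^2 elements of C_p x C_p are killed by \<open>p\<close>, while z^p = 1 has only
  \<open>p\<close> complex solutions.\<close>

lemma circle_group_no_square_of_cyclic:
  assumes "prime p" "h \<in> hom (integer_mod_group p \<times>\<times> integer_mod_group p) circle_group"
  shows "\<not> inj_on h (carrier (integer_mod_group p \<times>\<times> integer_mod_group p))"
proof
  let ?C = "integer_mod_group p"
  assume inj: "inj_on h (carrier (?C \<times>\<times> ?C))"
  have p: "p > 1" using assms(1) by (rule prime_gt_1_nat)
  interpret h: group_hom "?C \<times>\<times> ?C" circle_group h
    using assms by (simp add: group_hom_def group_hom_axioms_def DirProd_group circle.is_group)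
  have pow: "x [^]\<^bsub>?C \<times>\<times> ?C\<^esub> (n::nat) = (fst x [^]\<^bsub>?C\<^esub> n, snd x [^]\<^bsub>?C\<^esub> n)" for x n
    by (induction n) (auto simp: nat_pow_def mult_DirProd' integer_mod_group_def)
  have "h ` carrier (?C \<times>\<times> ?C) \<subseteq> {z. z ^ p = 1}"
  proof clarify
    fix x y assume "(x, y) \<in> carrier (?C \<times>\<times> ?C)"
    then have "h (x, y) ^ p = h ((x, y) [^]\<^bsub>?C \<times>\<times> ?C\<^esub> p)"
      using h.hom_nat_pow by simp
    also have "\<dots> = 1" using h.hom_one by (simp add: pow)
    finally show "h (x, y) ^ p = 1" .
  qed
  then have "card (h ` carrier (?C \<times>\<times> ?C)) \<le> card {z::complex. z ^ p = 1}"
    using p by (intro card_mono finite_roots_unity) auto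
  also have "\<dots> = p" using p by (simp add: card_roots_unity_eq)
  finally show False
    using p inj by (simp add: card_image carrier_integer_mod_group)
qed

section \<open>Partial embeddings and their one-step extensions\<close>

lemma int_pow_DirProd:
  assumes "group G" "group K" "x \<in> carrier G" "y \<in> carrier K"
  shows "(x, y) [^]\<^bsub>G \<times>\<times> K\<^esub> (n::int) = (x [^]\<^bsub>G\<^esub> n, y [^]\<^bsub>K\<^esub> n)"
proof -
  interpret group_hom "G \<times>\<times> K" G fst
    using assms by (auto simp: group_hom_def group_hom_axioms_def DirProd_group hom_def mult_DirProd')
  interpret snd: group_hom "G \<times>\<times> K" K snd
    using assms by (auto simp: group_hom_def group_hom_axioms_def DirProd_group hom_def mult_DirProd')
  show ?thesis
    using hom_int_pow[of "(x, y)" n] snd.hom_int_pow[of "(x, y)" n] assms by (simp add: prod_eq_iff)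
qed

text \<open>Independence is assumed for positive natural exponents only; this carries it over to
  nonzero integer exponents.\<close>

lemma (in group) nat_pow_abs_mem:
  assumes H: "subgroup H G" and x: "x \<in> carrier G" and xn: "x [^] (n::int) \<in> H"
  shows "x [^] nat \<bar>n\<bar> \<in> H"
proof (cases "n \<ge> 0")
  case True
  with xn show ?thesis by (simp flip: int_pow_int)
next
  case False
  then have "x [^] nat \<bar>n\<bar> = inv (x [^] n)"
    using x by (simp add: int_pow_neg flip: int_pow_int)
  with subgroup.m_inv_closed[OF H xn] show ?thesis by simp
qed

text \<open>The graph of an isomorphism from \<open>Domain R\<close> onto \<open>Range R\<close>.
  Testing identities is enough: two pairs that agree in one component have a quotient with an
  identity there, so \<open>R\<close> is single-valued and injective. Graphs make extension plain
  inclusion, as Zorn's lemma wants it.\<close>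

definition partial_embedding ::
  "('a, 'b) monoid_scheme \<Rightarrow> ('c, 'd) monoid_scheme \<Rightarrow> ('a \<times> 'c) set \<Rightarrow> bool" where
  "partial_embedding G K R \<longleftrightarrow>
     subgroup R (G \<times>\<times> K) \<and> (\<forall>(x, y) \<in> R. x = \<one>\<^bsub>G\<^esub> \<longleftrightarrow> y = \<one>\<^bsub>K\<^esub>)"

text \<open>For a subgroup \<open>R\<close> of the product of two abelian groups, this is the
  subgroup generated by \<open>R\<close> and the pair \<open>(x, y)\<close>.\<close>

definition adjoin_pair ::
  "('a, 'b) monoid_scheme \<Rightarrow> ('c, 'd) monoid_scheme \<Rightarrow> ('a \<times> 'c) set \<Rightarrow> 'a \<Rightarrow> 'c \<Rightarrow> ('a \<times> 'c) set" where
  "adjoin_pair G K R x y =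
     {(h \<otimes>\<^bsub>G\<^esub> x [^]\<^bsub>G\<^esub> n, k \<otimes>\<^bsub>K\<^esub> y [^]\<^bsub>K\<^esub> n) | h k (n::int). (h, k) \<in> R}"

locale two_comm_groups = G: comm_group G + K: comm_group K
  for G :: "('a, 'b) monoid_scheme" (structure) and K :: "('c, 'd) monoid_scheme" (structure)
begin

lemma partial_embeddingD:
  assumes "partial_embedding G K R"
  shows "\<And>x y. (x, y) \<in> R \<Longrightarrow> x \<in> carrier G \<and> y \<in> carrier K"
    and "(\<one>\<^bsub>G\<^esub>, \<one>\<^bsub>K\<^esub>) \<in> R"
    and "\<And>x y. (x, y) \<in> R \<Longrightarrow> (inv\<^bsub>G\<^esub> x, inv\<^bsub>K\<^esub> y) \<in> R"
    and "\<And>x y x' y'. (x, y) \<in> R \<Longrightarrow> (x', y') \<in> R \<Longrightarrow> (x \<otimes>\<^bsub>G\<^esub> x', y \<otimes>\<^bsub>K\<^esub> y') \<in> R"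
    and "\<And>x y. (x, y) \<in> R \<Longrightarrow> (x [^]\<^bsub>G\<^esub> (n::int), y [^]\<^bsub>K\<^esub> n) \<in> R"
    and "\<And>x y. (x, y) \<in> R \<Longrightarrow> x = \<one>\<^bsub>G\<^esub> \<longleftrightarrow> y = \<one>\<^bsub>K\<^esub>"
proof -
  have R: "subgroup R (G \<times>\<times> K)" and one: "\<And>x y. (x, y) \<in> R \<Longrightarrow> x = \<one>\<^bsub>G\<^esub> \<longleftrightarrow> y = \<one>\<^bsub>K\<^esub>"
    using assms by (auto simp: partial_embedding_def)
  show 1: "\<And>x y. (x, y) \<in> R \<Longrightarrow> x \<in> carrier G \<and> y \<in> carrier K"
    using subgroup.subset[OF R] by auto
  show "(\<one>\<^bsub>G\<^esub>, \<one>\<^bsub>K\<^esub>) \<in> R"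
    using subgroup.one_closed[OF R] by simp
  show "(inv\<^bsub>G\<^esub> x, inv\<^bsub>K\<^esub> y) \<in> R" if "(x, y) \<in> R" for x y
    using subgroup.m_inv_closed[OF R that] 1[OF that] by simp
  show "(x \<otimes>\<^bsub>G\<^esub> x', y \<otimes>\<^bsub>K\<^esub> y') \<in> R" if "(x, y) \<in> R" "(x', y') \<in> R" for x y x' y'
    using subgroup.m_closed[OF R that] by simp
  show "(x [^]\<^bsub>G\<^esub> n, y [^]\<^bsub>K\<^esub> n) \<in> R" if "(x, y) \<in> R" for x y
    using group.subgroup_int_pow_closed[OF _ R that, of n] 1[OF that]
    by (simp add: DirProd_group int_pow_DirProd)
  show "\<And>x y. (x, y) \<in> R \<Longrightarrow> x = \<one>\<^bsub>G\<^esub> \<longleftrightarrow> y = \<one>\<^bsub>K\<^esub>" by (rule one)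
qed

lemma partial_embedding_eq_iff:
  assumes R: "partial_embedding G K R" and "(a, b) \<in> R" "(a', b') \<in> R"
  shows "a = a' \<longleftrightarrow> b = b'"
proof -
  note RD = partial_embeddingD[OF R]
  have "a \<otimes>\<^bsub>G\<^esub> inv\<^bsub>G\<^esub> a' = \<one>\<^bsub>G\<^esub> \<longleftrightarrow> b \<otimes>\<^bsub>K\<^esub> inv\<^bsub>K\<^esub> b' = \<one>\<^bsub>K\<^esub>"
    using RD(6)[OF RD(4)[OF assms(2) RD(3)[OF assms(3)]]] .
  then show ?thesis
    using RD(1)[OF assms(2)] RD(1)[OF assms(3)] by (simp add: G.inv_solve_right' K.inv_solve_right')
qed

lemma partial_embeddingI:
  assumes "\<And>x y. (x, y) \<in> R \<Longrightarrow> x \<in> carrier G \<and> y \<in> carrier K" "R \<noteq> {}"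
    and "\<And>x y. (x, y) \<in> R \<Longrightarrow> (inv\<^bsub>G\<^esub> x, inv\<^bsub>K\<^esub> y) \<in> R"
    and "\<And>x y x' y'. (x, y) \<in> R \<Longrightarrow> (x', y') \<in> R \<Longrightarrow> (x \<otimes>\<^bsub>G\<^esub> x', y \<otimes>\<^bsub>K\<^esub> y') \<in> R"
    and "\<And>x y. (x, y) \<in> R \<Longrightarrow> x = \<one>\<^bsub>G\<^esub> \<longleftrightarrow> y = \<one>\<^bsub>K\<^esub>"
  shows "partial_embedding G K R"
proof -
  have "subgroup R (G \<times>\<times> K)"
  proof (rule group.subgroupI)
    show "group (G \<times>\<times> K)" by (simp add: DirProd_group)
    show "inv\<^bsub>G \<times>\<times> K\<^esub> a \<in> R" if "a \<in> R" for a
      using that assms(1,3) by (cases a) auto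
    show "a \<otimes>\<^bsub>G \<times>\<times> K\<^esub> b \<in> R" if "a \<in> R" "b \<in> R" for a b
      using that assms(4) by (cases a; cases b) auto
  qed (use assms in auto)
  with assms(5) show ?thesis by (auto simp: partial_embedding_def)
qed

lemma subgroup_Domain_Range:
  assumes "partial_embedding G K R"
  shows "subgroup (Domain R) G" "subgroup (Range R) K"
proof -
  note R = partial_embeddingD[OF assms]
  show "subgroup (Domain R) G"
  proof (rule G.subgroupI)
    show "inv\<^bsub>G\<^esub> a \<in> Domain R" if "a \<in> Domain R" for a using that R(3) by blast
    show "a \<otimes>\<^bsub>G\<^esub> b \<in> Domain R" if "a \<in> Domain R" "b \<in> Domain R" for a b using that R(4) by blast
  qed (use R(1,2) in blast)+
  show "subgroup (Range R) K"
  proof (rule K.subgroupI)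
    show "inv\<^bsub>K\<^esub> a \<in> Range R" if "a \<in> Range R" for a using that R(3) by blast
    show "a \<otimes>\<^bsub>K\<^esub> b \<in> Range R" if "a \<in> Range R" "b \<in> Range R" for a b using that R(4) by blast
  qed (use R(1,2) in blast)+
qed

text \<open>The hypothesis \<open>rel\<close> says that \<open>R\<close> and the new assignment
  agree wherever a power of \<open>x\<close> or of \<open>y\<close> is already taken. This is
  exactly what keeps the kernels on both sides trivial.\<close>

lemma partial_embedding_adjoin_pair:
  assumes R: "partial_embedding G K R" and x: "x \<in> carrier G" and y: "y \<in> carrier K"
    and rel: "\<And>(n::int) h k. (h, k) \<in> R \<Longrightarrow> h = x [^]\<^bsub>G\<^esub> n \<longleftrightarrow> k = y [^]\<^bsub>K\<^esub> n"
  shows "partial_embedding G K (adjoin_pair G K R x y)"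
proof -
  note R = partial_embeddingD[OF R]
  have memI: "(h \<otimes>\<^bsub>G\<^esub> x [^]\<^bsub>G\<^esub> n, k \<otimes>\<^bsub>K\<^esub> y [^]\<^bsub>K\<^esub> n) \<in> adjoin_pair G K R x y"
    if "(h, k) \<in> R" for h k and n :: int
    using that unfolding adjoin_pair_def by blast
  show ?thesis
  proof (rule partial_embeddingI)
    show "adjoin_pair G K R x y \<noteq> {}" using memI[OF R(2)] by blast
  next
    fix a b assume "(a, b) \<in> adjoin_pair G K R x y"
    then obtain h k and n :: int where *: "(h, k) \<in> R"
      "a = h \<otimes>\<^bsub>G\<^esub> x [^]\<^bsub>G\<^esub> n" "b = k \<otimes>\<^bsub>K\<^esub> y [^]\<^bsub>K\<^esub> n"
      unfolding adjoin_pair_def by blast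
    have hk: "h \<in> carrier G" "k \<in> carrier K" using R(1)[OF *(1)] by auto
    show "a \<in> carrier G \<and> b \<in> carrier K" using * hk x y by simp
    show "(inv\<^bsub>G\<^esub> a, inv\<^bsub>K\<^esub> b) \<in> adjoin_pair G K R x y"
      using memI[OF R(3)[OF *(1)], of "-n"] * hk x y
      by (simp add: G.int_pow_neg K.int_pow_neg G.inv_mult K.inv_mult)
    \<comment> \<open>A product is trivial iff one factor inverts the other, so \<open>rel\<close>
      decides the matter when applied to the inverse of the pair \<open>(h, k)\<close>.\<close>
    have "a = \<one>\<^bsub>G\<^esub> \<longleftrightarrow> inv\<^bsub>G\<^esub> h = x [^]\<^bsub>G\<^esub> n"
      using * hk x by (metis G.inv_equality G.inv_inv G.inv_closed G.int_pow_closed G.r_inv G.m_comm)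
    moreover have "b = \<one>\<^bsub>K\<^esub> \<longleftrightarrow> inv\<^bsub>K\<^esub> k = y [^]\<^bsub>K\<^esub> n"
      using * hk y by (metis K.inv_equality K.inv_inv K.inv_closed K.int_pow_closed K.r_inv K.m_comm)
    ultimately show "a = \<one>\<^bsub>G\<^esub> \<longleftrightarrow> b = \<one>\<^bsub>K\<^esub>"
      using rel[OF R(3)[OF *(1)]] by blast
    fix a' b' assume "(a', b') \<in> adjoin_pair G K R x y"
    then obtain h' k' and n' :: int where **: "(h', k') \<in> R"
      "a' = h' \<otimes>\<^bsub>G\<^esub> x [^]\<^bsub>G\<^esub> n'" "b' = k' \<otimes>\<^bsub>K\<^esub> y [^]\<^bsub>K\<^esub> n'"
      unfolding adjoin_pair_def by blast
    have hk': "h' \<in> carrier G" "k' \<in> carrier K" using R(1)[OF **(1)] by auto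
    show "(a \<otimes>\<^bsub>G\<^esub> a', b \<otimes>\<^bsub>K\<^esub> b') \<in> adjoin_pair G K R x y"
      using memI[OF R(4)[OF *(1) **(1)], of "n + n'"] * ** hk hk' x y
      by (simp add: G.int_pow_mult K.int_pow_mult G.m_ac K.m_ac)
  qed
qed

lemma adjoin_pair_mem:
  assumes "partial_embedding G K R" "x \<in> carrier G" "y \<in> carrier K"
  shows "R \<subseteq> adjoin_pair G K R x y" "(x, y) \<in> adjoin_pair G K R x y"
proof -
  note R = partial_embeddingD[OF assms(1)]
  show "R \<subseteq> adjoin_pair G K R x y"
  proof clarify
    fix h k assume "(h, k) \<in> R"
    then show "(h, k) \<in> adjoin_pair G K R x y"
      using R(1) unfolding adjoin_pair_def
      by (intro CollectI exI[of _ h] exI[of _ k] exI[of _ "0::int"]) auto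
  qed
  show "(x, y) \<in> adjoin_pair G K R x y"
    using R(2) assms unfolding adjoin_pair_def
    by (intro CollectI exI[of _ "\<one>\<^bsub>G\<^esub>"] exI[of _ "\<one>\<^bsub>K\<^esub>"] exI[of _ "1::int"]) auto
qed

text \<open>For n = 0 the compatibility condition is triviality of kernels in \<open>R\<close>; for
  n nonzero both of its sides are false.\<close>

lemma partial_embedding_adjoin_independent:
  assumes R: "partial_embedding G K R" and x: "x \<in> carrier G" and y: "y \<in> carrier K"
    and nx: "\<And>n::nat. n > 0 \<Longrightarrow> x [^]\<^bsub>G\<^esub> n \<notin> Domain R"
    and ny: "\<And>n::nat. n > 0 \<Longrightarrow> y [^]\<^bsub>K\<^esub> n \<notin> Range R"
  shows "partial_embedding G K (adjoin_pair G K R x y)"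
proof (rule partial_embedding_adjoin_pair[OF R x y])
  note D = subgroup_Domain_Range[OF R]
  fix n :: int and h k assume hk: "(h, k) \<in> R"
  show "h = x [^]\<^bsub>G\<^esub> n \<longleftrightarrow> k = y [^]\<^bsub>K\<^esub> n"
  proof (cases "n = 0")
    case True
    then show ?thesis using partial_embeddingD(6)[OF R hk] by simp
  next
    case False
    then have n: "nat \<bar>n\<bar> > 0" by simp
    have "x [^]\<^bsub>G\<^esub> n \<notin> Domain R" "y [^]\<^bsub>K\<^esub> n \<notin> Range R"
      using G.nat_pow_abs_mem[OF D(1) x, of n] nx[OF n] K.nat_pow_abs_mem[OF D(2) y, of n] ny[OF n]
      by blast+
    then show ?thesis using hk by blast
  qed
qed

text \<open>If \<open>p\<close> divides \<open>n\<close>, the pair of n-th powers is a power of a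
  pair in \<open>R\<close>. Otherwise \<open>n\<close> is coprime to \<open>p\<close>, and an n-th
  power inside the domain or range would pull in \<open>x\<close> or \<open>y\<close>
  itself.\<close>

lemma partial_embedding_adjoin_root:
  assumes R: "partial_embedding G K R" and x: "x \<in> carrier G" and y: "y \<in> carrier K"
    and p: "prime p" and xy: "(x [^]\<^bsub>G\<^esub> (p::nat), y [^]\<^bsub>K\<^esub> p) \<in> R" and nx: "x \<notin> Domain R" and ny: "y \<notin> Range R"
  shows "partial_embedding G K (adjoin_pair G K R x y)"
proof (rule partial_embedding_adjoin_pair[OF R x y])
  note D = subgroup_Domain_Range[OF R]
  fix n :: int and h k assume hk: "(h, k) \<in> R"
  show "h = x [^]\<^bsub>G\<^esub> n \<longleftrightarrow> k = y [^]\<^bsub>K\<^esub> n"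
  proof (cases "int p dvd n")
    case True
    then obtain m where n: "n = int p * m" by blast
    have "(x [^]\<^bsub>G\<^esub> n, y [^]\<^bsub>K\<^esub> n) \<in> R"
      using partial_embeddingD(5)[OF R xy, of m] x y n
      by (simp add: G.int_pow_pow K.int_pow_pow flip: int_pow_int)
    from partial_embedding_eq_iff[OF R hk this] show ?thesis .
  next
    case False
    then have "coprime (int p) n" using p by (simp add: prime_imp_coprime)
    moreover have "x [^]\<^bsub>G\<^esub> int p \<in> Domain R" "y [^]\<^bsub>K\<^esub> int p \<in> Range R"
      using xy by (auto simp: int_pow_int)
    ultimately have "x [^]\<^bsub>G\<^esub> n \<notin> Domain R" "y [^]\<^bsub>K\<^esub> n \<notin> Range R"
      using G.mem_subgroup_if_coprime_pows[OF D(1) x] K.mem_subgroup_if_coprime_pows[OF D(2) y] nx ny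
      by blast+
    then show ?thesis using hk by blast
  qed
qed

text \<open>If every \<open>p\<close>-th root of \<open>w\<close> had a preimage, dividing these preimages and \<open>x\<close> itself by \<open>x\<close>
  would produce \<open>p + 1\<close> elements killed by \<open>p\<close>.\<close>
lemma root_outside_Range:
  assumes R: "partial_embedding G K R" and x: "x \<in> carrier G" "x \<notin> Domain R"
    and xw: "(x [^]\<^bsub>G\<^esub> (p::nat), w) \<in> R"
    and Y: "card Y = p" "p > 0" "\<And>y. y \<in> Y \<Longrightarrow> y [^]\<^bsub>K\<^esub> p = w"
    and tors: "\<And>S. finite S \<Longrightarrow> S \<subseteq> {t \<in> carrier G. t [^]\<^bsub>G\<^esub> p = \<one>\<^bsub>G\<^esub>} \<Longrightarrow> card S \<le> p"
  shows "\<exists>y\<in>Y. y \<notin> Range R"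
proof (rule ccontr)
  assume "\<not> (\<exists>y\<in>Y. y \<notin> Range R)"
  then have "\<forall>y\<in>Y. \<exists>x. (x, y) \<in> R" by blast
  then obtain g where g: "\<And>y. y \<in> Y \<Longrightarrow> (g y, y) \<in> R" by metis
  \<comment> \<open>An infinite \<open>Y\<close> would have \<open>card Y = 0\<close>, against
    \<open>p > 0\<close>.\<close>
  have "finite Y" using Y by (metis card.infinite less_irrefl)
  note RD = partial_embeddingD[OF R]
  note uniq = partial_embedding_eq_iff[OF R]
  let ?S = "insert x (g ` Y)"
  have S: "a \<in> carrier G \<and> a [^]\<^bsub>G\<^esub> p = x [^]\<^bsub>G\<^esub> p" if a: "a \<in> ?S" for a
  proof (cases "a = x")
    case False
    then obtain y where y: "y \<in> Y" "a = g y" using a by blast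
    have "(g y [^]\<^bsub>G\<^esub> p, y [^]\<^bsub>K\<^esub> p) \<in> R"
      using RD(5)[OF g[OF y(1)], of "int p"] by (simp add: int_pow_int)
    then show ?thesis using uniq[OF _ xw] Y(3)[OF y(1)] y RD(1)[OF g] by blast
  qed (use x in simp)
  let ?T = "(\<lambda>a. a \<otimes>\<^bsub>G\<^esub> inv\<^bsub>G\<^esub> x) ` ?S"
  have "inj_on g Y" using uniq g by (metis inj_onI)
  moreover have "x \<notin> g ` Y" using x(2) g by blast
  ultimately have "card ?S = p + 1" using \<open>finite Y\<close> Y(1) by (simp add: card_image)
  moreover have "inj_on (\<lambda>a. a \<otimes>\<^bsub>G\<^esub> inv\<^bsub>G\<^esub> x) ?S"
    using S x(1) by (intro inj_onI) (metis G.inv_closed G.right_cancel)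
  ultimately have "card ?T = p + 1" by (simp only: card_image)
  moreover have "?T \<subseteq> {t \<in> carrier G. t [^]\<^bsub>G\<^esub> p = \<one>\<^bsub>G\<^esub>}"
  proof (rule image_subsetI)
    fix a assume "a \<in> ?S"
    from S[OF this] x(1) show "a \<otimes>\<^bsub>G\<^esub> inv\<^bsub>G\<^esub> x \<in> {t \<in> carrier G. t [^]\<^bsub>G\<^esub> p = \<one>\<^bsub>G\<^esub>}"
      by (simp add: G.pow_mult_distrib G.m_comm G.nat_pow_inv)
  qed
  ultimately show False using tors[of ?T] \<open>finite Y\<close> by fastforce
qed

section \<open>Unions of chains and a maximal partial embedding\<close>

lemma partial_embedding_Union:
  assumes C: "\<C> \<noteq> {}" "subset.chain \<A> \<C>" and A: "\<And>R. R \<in> \<A> \<Longrightarrow> partial_embedding G K R"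
  shows "partial_embedding G K (\<Union>\<C>)"
proof (rule partial_embeddingI)
  have RC: "partial_embedding G K R" if "R \<in> \<C>" for R
    using that C A by (auto simp: subset.chain_def)
  show "\<Union>\<C> \<noteq> {}" using C(1) RC partial_embeddingD(2) by blast
  fix x y assume "(x, y) \<in> \<Union>\<C>"
  then obtain R where R: "R \<in> \<C>" "(x, y) \<in> R" by blast
  note RD = partial_embeddingD[OF RC[OF R(1)]]
  show "x \<in> carrier G \<and> y \<in> carrier K" "(inv\<^bsub>G\<^esub> x, inv\<^bsub>K\<^esub> y) \<in> \<Union>\<C>"
    "x = \<one>\<^bsub>G\<^esub> \<longleftrightarrow> y = \<one>\<^bsub>K\<^esub>"
    using RD(1,3,6)[OF R(2)] R(1) by blast+
  fix x' y' assume "(x', y') \<in> \<Union>\<C>"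
  then obtain R' where R': "R' \<in> \<C>" "(x', y') \<in> R'" by blast
  \<comment> \<open>Two members of a chain are comparable, so the larger one contains both pairs and
    hence their product.\<close>
  obtain S where "S \<in> \<C>" "R \<subseteq> S" "R' \<subseteq> S"
    using C(2) R(1) R'(1) by (metis subset.chain_def subset_chain_def order_refl)
  then show "(x \<otimes>\<^bsub>G\<^esub> x', y \<otimes>\<^bsub>K\<^esub> y') \<in> \<Union>\<C>"
    using partial_embeddingD(4)[OF RC, of S] R R' by blast
qed

lemma hom_of_total_partial_embedding:
  assumes R: "partial_embedding G K R" and dom: "carrier G \<subseteq> Domain R"
  obtains h where "h \<in> hom G K" "inj_on h (carrier G)"
proof -
  note RD = partial_embeddingD[OF R]
  note uniq = partial_embedding_eq_iff[OF R]
  have "\<forall>x\<in>carrier G. \<exists>y. (x, y) \<in> R" using dom by blast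
  then obtain h where h: "\<And>x. x \<in> carrier G \<Longrightarrow> (x, h x) \<in> R" by metis
  show ?thesis
  proof (rule that)
    show "h \<in> hom G K"
    proof (rule homI)
      show "h x \<in> carrier K" if "x \<in> carrier G" for x using h[OF that] RD(1) by blast
      show "h (x \<otimes>\<^bsub>G\<^esub> y) = h x \<otimes>\<^bsub>K\<^esub> h y" if "x \<in> carrier G" "y \<in> carrier G" for x y
        using uniq[OF h[OF G.m_closed[OF that]] RD(4)[OF h[OF that(1)] h[OF that(2)]]] by simp
    qed
    show "inj_on h (carrier G)"
    proof (rule inj_onI)
      fix x y assume "x \<in> carrier G" "y \<in> carrier G" "h x = h y"
      then show "x = y" using uniq[OF h h, of x y] by simp
    qed
  qed
qed

text \<open>\<open>E A\<close> confines the values of an embedding defined on \<open>A\<close>. Without it a maximal partial embedding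
  could exhaust \<open>K\<close> up to torsion before reaching all of \<open>G\<close>.\<close>
lemma exists_embedding:
  fixes E :: "'a set \<Rightarrow> 'c set"
  assumes sub: "\<And>A. A \<subseteq> carrier G \<Longrightarrow> subgroup (E A) K"
    and mono: "\<And>A B. A \<subseteq> B \<Longrightarrow> E A \<subseteq> E B"
    and root: "\<And>A y n. y \<in> carrier K \<Longrightarrow> (n::nat) > 0 \<Longrightarrow> y [^]\<^bsub>K\<^esub> n \<in> E A \<Longrightarrow> y \<in> E A"
    and new: "\<And>A x. A \<subseteq> carrier G \<Longrightarrow> x \<in> carrier G \<Longrightarrow> x \<notin> A \<Longrightarrow>
      \<exists>y\<in>E (insert x A). \<forall>n::nat. n > 0 \<longrightarrow> y [^]\<^bsub>K\<^esub> n \<notin> E A"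
    and roots: "\<And>p w. prime p \<Longrightarrow> w \<in> carrier K \<Longrightarrow> card {y \<in> carrier K. y [^]\<^bsub>K\<^esub> (p::nat) = w} = p"
    and tors: "\<And>p S. prime (p::nat) \<Longrightarrow> S \<subseteq> {t \<in> carrier G. t [^]\<^bsub>G\<^esub> p = \<one>\<^bsub>G\<^esub>} \<Longrightarrow> card S \<le> p"
  obtains h where "h \<in> hom G K" "inj_on h (carrier G)"
proof -
  define \<A> where "\<A> = {R. partial_embedding G K R \<and> Range R \<subseteq> E (Domain R)}"
  have E_carrier: "E A \<subseteq> carrier K" if "A \<subseteq> carrier G" for A
    using subgroup.subset[OF sub[OF that]] .
  have "\<exists>M\<in>\<A>. \<forall>X\<in>\<A>. M \<subseteq> X \<longrightarrow> X = M"
  proof (rule subset_Zorn_nonempty)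
    \<comment> \<open>This form of Zorn's lemma treats nonempty chains only, so a starting element
      is supplied: the trivial embedding.\<close>
    have "partial_embedding G K {(\<one>\<^bsub>G\<^esub>, \<one>\<^bsub>K\<^esub>)}"
      by (rule partial_embeddingI) auto
    moreover have "\<one>\<^bsub>K\<^esub> \<in> E {\<one>\<^bsub>G\<^esub>}"
      by (rule subgroup.one_closed[OF sub]) simp
    ultimately have "{(\<one>\<^bsub>G\<^esub>, \<one>\<^bsub>K\<^esub>)} \<in> \<A>"
      by (simp add: \<A>_def)
    then show "\<A> \<noteq> {}" by blast
  next
    fix \<C> assume C: "\<C> \<noteq> {}" "subset.chain \<A> \<C>"
    have "Range (\<Union>\<C>) \<subseteq> E (Domain (\<Union>\<C>))"
    proof
      fix y assume "y \<in> Range (\<Union>\<C>)"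
      then obtain R where "R \<in> \<C>" "y \<in> Range R" by blast
      moreover have "Domain R \<subseteq> Domain (\<Union>\<C>)" using \<open>R \<in> \<C>\<close> by blast
      moreover have "Range R \<subseteq> E (Domain R)"
        using C(2) \<open>R \<in> \<C>\<close> by (auto simp: subset.chain_def \<A>_def)
      ultimately show "y \<in> E (Domain (\<Union>\<C>))"
        using mono by blast
    qed
    then show "\<Union>\<C> \<in> \<A>"
      using partial_embedding_Union[OF C] by (simp add: \<A>_def)
  qed
  then obtain R where RA: "R \<in> \<A>" and max: "\<And>X. X \<in> \<A> \<Longrightarrow> R \<subseteq> X \<Longrightarrow> X = R"
    by metis
  have R: "partial_embedding G K R" and RE: "Range R \<subseteq> E (Domain R)"
    using RA by (simp_all add: \<A>_def)
  note RD = partial_embeddingD[OF R]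
  have D: "subgroup (Domain R) G" by (rule subgroup_Domain_Range[OF R])
  \<comment> \<open>No proper extension by one pair exists: if its new value obeys the bound
    \<open>E\<close>, then so do all its values, since \<open>E\<close> of the larger domain is a
    subgroup, and maximality is contradicted.\<close>
  have stuck: False
    if x: "x \<in> carrier G" "x \<notin> Domain R" and y: "y \<in> E (insert x (Domain R))"
      and emb: "partial_embedding G K (adjoin_pair G K R x y)" for x y
  proof -
    let ?X = "adjoin_pair G K R x y"
    have yK: "y \<in> carrier K" using y x E_carrier[of "insert x (Domain R)"] subgroup.subset[OF D] by blast
    note X = adjoin_pair_mem[OF R x(1) yK]
    have DX: "insert x (Domain R) \<subseteq> Domain ?X" using X by blast
    then have yE: "y \<in> E (Domain ?X)" using mono y by blast
    have EX: "subgroup (E (Domain ?X)) K"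
      by (intro sub subgroup.subset subgroup_Domain_Range emb)
    have "Range ?X \<subseteq> E (Domain ?X)"
    proof
      fix b assume "b \<in> Range ?X"
      then obtain h k and n :: int where b: "(h, k) \<in> R" "b = k \<otimes>\<^bsub>K\<^esub> y [^]\<^bsub>K\<^esub> n"
        unfolding adjoin_pair_def by blast
      have "k \<in> E (Domain ?X)" using b(1) RE mono[of "Domain R" "Domain ?X"] DX by blast
      then show "b \<in> E (Domain ?X)"
        unfolding b(2) by (intro subgroup.m_closed[OF EX] K.subgroup_int_pow_closed[OF EX] yE)
    qed
    then have "?X = R" using emb by (intro max X(1)) (simp add: \<A>_def)
    then show False using X(2) x(2) by blast
  qed
  have "carrier G \<subseteq> Domain R"
  proof (rule ccontr)
    assume "\<not> carrier G \<subseteq> Domain R"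
    then obtain x where x: "x \<in> carrier G" "x \<notin> Domain R" by blast
    show False
    proof (cases "\<exists>n::nat. n > 0 \<and> x [^]\<^bsub>G\<^esub> n \<in> Domain R")
      case False
      \<comment> \<open>Powers that avoid \<open>E (Domain R)\<close> avoid \<open>Range R\<close>
        too, because \<open>R\<close> obeys the bound.\<close>
      obtain y where y: "y \<in> E (insert x (Domain R))" "\<And>n::nat. n > 0 \<Longrightarrow> y [^]\<^bsub>K\<^esub> n \<notin> E (Domain R)"
        using new[OF subgroup.subset[OF D] x] by blast
      then have "y \<in> carrier K"
        using x E_carrier[of "insert x (Domain R)"] subgroup.subset[OF D] by blast
      then have "partial_embedding G K (adjoin_pair G K R x y)"
        using y(2) RE False by (intro partial_embedding_adjoin_independent[OF R x(1)]) blast+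
      then show False using stuck x y(1) by blast
    next
      case True
      define n where "n = (LEAST n::nat. n > 0 \<and> x [^]\<^bsub>G\<^esub> n \<in> Domain R)"
      have n: "n > 0" "x [^]\<^bsub>G\<^esub> n \<in> Domain R"
        using LeastI_ex[OF True] by (auto simp: n_def)
      have least: "x [^]\<^bsub>G\<^esub> m \<notin> Domain R" if "0 < m" "m < n" for m
        using that not_less_Least[of m] by (auto simp: n_def)
      \<comment> \<open>Since \<open>x\<close> is outside the domain, \<open>n\<close> exceeds 1 and
        has a prime divisor \<open>p\<close>. By minimality of \<open>n\<close> the power with
        exponent n/p is still outside, while its p-th power is inside.\<close>
      have "n \<noteq> 1" using n(2) x by auto
      then obtain p where p: "prime p" "p dvd n" using prime_factor_nat by blast
      then obtain m where m: "n = m * p" by (metis dvd_def mult.commute)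
      define z where "z = x [^]\<^bsub>G\<^esub> m"
      have "0 < m" "m < n" using m n(1) prime_gt_1_nat[OF p(1)] by auto
      then have z: "z \<in> carrier G" "z \<notin> Domain R" using least x by (auto simp: z_def)
      have "z [^]\<^bsub>G\<^esub> p \<in> Domain R" using n(2) m x(1) by (simp add: z_def G.nat_pow_pow)
      then obtain w where w: "(z [^]\<^bsub>G\<^esub> p, w) \<in> R" by blast
      have wK: "w \<in> carrier K" using RD(1)[OF w] by blast
      have "\<exists>y\<in>{y \<in> carrier K. y [^]\<^bsub>K\<^esub> p = w}. y \<notin> Range R"
        using roots[OF p(1) wK] prime_gt_0_nat[OF p(1)] tors[OF p(1)]
        by (intro root_outside_Range[OF R z w]) auto
      then obtain y where y: "y \<in> carrier K" "y [^]\<^bsub>K\<^esub> p = w" "y \<notin> Range R" by blast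
      \<comment> \<open>A root of a value already lies in \<open>E (Domain R)\<close>; monotonicity
        only brings this into the form that \<open>stuck\<close> expects.\<close>
      have "y [^]\<^bsub>K\<^esub> p \<in> E (Domain R)" using w y(2) RE by blast
      then have "y \<in> E (insert z (Domain R))"
        using root[OF y(1) prime_gt_0_nat[OF p(1)]] mono[OF subset_insertI] by blast
      moreover have "partial_embedding G K (adjoin_pair G K R z y)"
        using partial_embedding_adjoin_root[OF R z(1) y(1) p(1) _ z(2) y(3)] w y(2) by simp
      ultimately show False using stuck z by blast
    qed
  qed
  then show ?thesis using hom_of_total_partial_embedding[OF R] that by blast
qed

end

section \<open>Cardinality of Hamel bases of the reals\<close>

lemma times_lepoll_self:
  assumes "infinite A"
  shows "A \<times> A \<lesssim> A"
  using card_of_Times_same_infinite[OF assms]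
  by (simp add: eqpoll_iff_card_of_ordIso eqpoll_imp_lepoll)

text \<open>Lists of each fixed length embed into \<open>A\<close> by induction, via A x A; the
  union over all lengths is countable and \<open>A\<close> is infinite.\<close>

lemma lists_lepoll_self:
  assumes A: "infinite A"
  shows "lists A \<lesssim> A"
proof -
  have len: "{xs \<in> lists A. length xs = n} \<lesssim> A" for n
  proof (induction n)
    case 0
    have "{xs \<in> lists A. length xs = 0} \<subseteq> {[]}" by auto
    then show ?case using A by (meson finite_lepoll_infinite finite_subset finite.intros)
  next
    case (Suc n)
    have "{xs \<in> lists A. length xs = Suc n} \<subseteq> (\<lambda>(x, xs). x # xs) ` (A \<times> {xs \<in> lists A. length xs = n})"
      by (auto simp: length_Suc_conv image_iff)
    then have "{xs \<in> lists A. length xs = Suc n} \<lesssim> A \<times> {xs \<in> lists A. length xs = n}"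
      by (rule subset_image_lepoll)
    also have "\<dots> \<lesssim> A \<times> A" by (intro times_lepoll_mono Suc lepoll_refl)
    also note times_lepoll_self[OF A]
    finally show ?case .
  qed
  have "lists A = (\<Union>n::nat. {xs \<in> lists A. length xs = n})" by auto
  also have "\<dots> \<lesssim> A"
    using len A[unfolded infinite_le_lepoll] unfolding lepoll_def card_of_ordLeq
    by (intro card_of_UNION_ordLeq_infinite[OF A] ballI)
  finally show ?thesis .
qed

interpretation rat_real: vector_space "\<lambda>(q::rat) (x::real). of_rat q * x"
  by standard (simp_all add: algebra_simps of_rat_add of_rat_mult)

text \<open>Each real is the value of a finite list of pairs of a rational coefficient and an
  element of \<open>B\<close>. Once \<open>B\<close> is known to be infinite, such lists are no more
  numerous than \<open>B\<close>.\<close>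

lemma real_lepoll_if_rat_span_UNIV:
  assumes "rat_real.span B = UNIV"
  shows "(UNIV :: real set) \<lesssim> B"
proof -
  let ?g = "\<lambda>xs :: (rat \<times> real) list. \<Sum>(q, b)\<leftarrow>xs. of_rat q * b"
  have "x \<in> ?g ` lists (UNIV \<times> B)" for x
  proof -
    have "x \<in> rat_real.span B" using assms by simp
    then show ?thesis
    proof (induction rule: rat_real.span_induct_alt)
      case base
      show ?case by (rule image_eqI[of _ _ "[]"]) auto
    next
      case (step c b y)
      then obtain xs where "y = ?g xs" "xs \<in> lists (UNIV \<times> B)" by (elim imageE)
      with step show ?case by (intro image_eqI[of _ _ "(c, b) # xs"]) auto
    qed
  qed
  then have le: "(UNIV :: real set) \<lesssim> lists ((UNIV :: rat set) \<times> B)"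
    by (intro subset_image_lepoll[where f = ?g]) blast
  \<comment> \<open>A countable \<open>B\<close> would leave only countably many lists, hence
    countably many reals.\<close>
  have "uncountable (lists ((UNIV :: rat set) \<times> B))"
    using countable_lepoll[OF _ le] uncountable_UNIV_real by blast
  then have "uncountable B"
    using countable_SIGMA[OF countableI_type, of _ "\<lambda>_. B"] countable_lists by blast
  then have B: "infinite B" using countable_finite by blast
  have "(UNIV :: rat set) \<lesssim> (UNIV :: nat set)" 
    using countableI_type[of "UNIV :: rat set"] unfolding countable_def lepoll_def by blast
  also have "\<dots> \<lesssim> B" using B unfolding infinite_le_lepoll .
  finally have "(UNIV :: rat set) \<times> B \<lesssim> B \<times> B" by (rule times_lepoll_mono) (rule lepoll_refl)
  also note times_lepoll_self[OF B]
  finally have "lists ((UNIV :: rat set) \<times> B) \<lesssim> lists B" by (rule lists_lepoll_mono)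
  with le show ?thesis using lists_lepoll_self[OF B] by (meson lepoll_trans)
qed

text \<open>Supplies a fresh real for each element of \<open>X\<close>, independent of the others
  and of 1. The number 1 is included because the integers form the kernel of the map from s to cis
  (2 pi s).\<close>

lemma rat_independent_family:
  assumes "X \<lesssim> (UNIV :: real set)"
  obtains \<iota> :: "'a \<Rightarrow> real"
  where "\<And>A x. A \<subseteq> X \<Longrightarrow> x \<in> X \<Longrightarrow> x \<notin> A \<Longrightarrow> \<iota> x \<notin> rat_real.span (insert 1 (\<iota> ` A))"
proof -
  define B where "B = rat_real.extend_basis {1}"
  have ind1: "rat_real.independent {1}" by (simp add: rat_real.dependent_single)
  have B: "1 \<in> B" "rat_real.independent B" "rat_real.span B = UNIV"
    using rat_real.extend_basis_superset[OF ind1] rat_real.independent_extend_basis[OF ind1]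
      rat_real.span_extend_basis[OF ind1] by (auto simp: B_def)
  have le: "(UNIV :: real set) \<lesssim> B" using real_lepoll_if_rat_span_UNIV[OF B(3)] .
  then have "infinite B"
    using uncountable_UNIV_real by (meson countable_finite countable_lepoll)
  then have "infinite (B - {1})" by simp
  \<comment> \<open>Dropping 1 from the infinite basis leaves room for all of \<open>X\<close>, and
    no value of \<open>\<iota>\<close> is then 1.\<close>
  then have "insert 1 (B - {1}) \<lesssim> B - {1}" by (rule infinite_insert_lepoll)
  then have "B \<lesssim> B - {1}" using B(1) by (simp add: insert_absorb)
  with assms le have "X \<lesssim> B - {1}" by (meson lepoll_trans)
  then obtain \<iota> where \<iota>: "inj_on \<iota> X" "\<iota> ` X \<subseteq> B - {1}" by (auto simp: lepoll_def)
  show ?thesis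
  proof (rule that[of \<iota>])
    fix A x assume *: "A \<subseteq> X" "x \<in> X" "x \<notin> A"
    then have "\<iota> x \<notin> \<iota> ` A" using \<iota>(1) by (meson inj_on_image_mem_iff)
    moreover have "insert 1 (\<iota> ` A) \<subseteq> B" "\<iota> x \<noteq> 1" using * \<iota>(2) B(1) by auto
    \<comment> \<open>The spanning set consists of basis elements other than
      \<open>\<iota> x\<close>, and no basis element lies in the span of the others.\<close>
    ultimately have "insert 1 (\<iota> ` A) \<subseteq> B - {\<iota> x}" by blast
    moreover have "\<iota> x \<notin> rat_real.span (B - {\<iota> x})"
      using B(2) * \<iota>(2) by (auto simp: rat_real.dependent_def)
    ultimately show "\<iota> x \<notin> rat_real.span (insert 1 (\<iota> ` A))"
      using rat_real.span_mono by blast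
  qed
qed

section \<open>Rational spans inside the circle and the faithful character\<close>

text \<open>The equation determines n r up to an integer. That integer is in the span because 1 is
  in \<open>S\<close>, and division by \<open>n\<close> is a rational scaling. So the image of the
  span in the circle is closed under roots.\<close>

lemma mem_rat_span_if_cis_power_eq:
  assumes "1 \<in> S" "n > 0" and s: "s \<in> rat_real.span S"
    and eq: "cis (2 * pi * r) ^ n = cis (2 * pi * s)"
  shows "r \<in> rat_real.span S"
proof -
  have "sin (real n * (2 * pi * r)) = sin (2 * pi * s) \<and> cos (real n * (2 * pi * r)) = cos (2 * pi * s)"
    using eq by (simp add: DeMoivre complex_eq_iff)
  then obtain k :: int where "real n * (2 * pi * r) = 2 * pi * s + 2 * pi * k"
    unfolding sin_cos_eq_iff by blast
  then have "2 * pi * (real n * r) = 2 * pi * (s + k)" by (simp add: algebra_simps)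
  then have "real n * r = s + k" by simp
  then have "r = of_rat (1 / of_nat n) * (s + of_rat (of_int k) * 1)"
    using \<open>n > 0\<close> by (simp add: of_rat_divide field_simps)
  also have "\<dots> \<in> rat_real.span S"
    using \<open>1 \<in> S\<close> by (intro rat_real.span_scale rat_real.span_add s rat_real.span_base)
  finally show ?thesis .
qed

lemma subgroup_cis_rat_span:
  "subgroup ((\<lambda>s. cis (2 * pi * s)) ` rat_real.span S) circle_group" (is "subgroup ?E _")
proof (rule circle.subgroupI)
  show "?E \<noteq> {}" using rat_real.span_zero by blast
next
  fix a assume "a \<in> ?E"
  then obtain s where s: "a = cis (2 * pi * s)" "s \<in> rat_real.span S" by blast
  show "inv\<^bsub>circle_group\<^esub> a \<in> ?E"
    using s rat_real.span_neg[OF s(2)] by (auto simp: intro!: image_eqI[of _ _ "- s"])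
  fix b assume "b \<in> ?E"
  then obtain t where t: "b = cis (2 * pi * t)" "t \<in> rat_real.span S" by blast
  show "a \<otimes>\<^bsub>circle_group\<^esub> b \<in> ?E"
    using s t rat_real.span_add[OF s(2) t(2)]
    by (auto simp: cis_mult algebra_simps intro!: image_eqI[of _ _ "s + t"])
qed auto

lemma exists_faithful_unitary_character:
  assumes "comm_group G" and card: "carrier G \<lesssim> (UNIV :: real set)"
    and no: "\<And>p. prime p \<Longrightarrow> \<not> has_subgroup_iso_to G (integer_mod_group p \<times>\<times> integer_mod_group p)"
  obtains \<chi> where "faithful_unitary_character G \<chi>"
proof -
  interpret comm_group G by fact
  interpret two_comm_groups G circle_group
    by (simp add: two_comm_groups_def comm_group_axioms comm_group_circle_group)
  obtain \<iota> :: "'a \<Rightarrow> real" where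
    \<iota>: "\<iota> x \<notin> rat_real.span (insert 1 (\<iota> ` A))"
      if "A \<subseteq> carrier G" "x \<in> carrier G" "x \<notin> A" for A x
    by (rule rat_independent_family[OF card]) iprover
  define E where "E A = (\<lambda>s. cis (2 * pi * s)) ` rat_real.span (insert 1 (\<iota> ` A))" for A
  have E_root: "r \<in> rat_real.span (insert 1 (\<iota> ` A))"
    if n: "n > 0" and mem: "cis (2 * pi * r) ^ n \<in> E A" for r n A
  proof -
    obtain s where "cis (2 * pi * r) ^ n = cis (2 * pi * s)" "s \<in> rat_real.span (insert 1 (\<iota> ` A))"
      using mem unfolding E_def by (rule imageE)
    then show ?thesis
      using mem_rat_span_if_cis_power_eq[OF insertI1 n] by simp
  qed
  obtain h where "h \<in> hom G circle_group" "inj_on h (carrier G)"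
  proof (rule exists_embedding[of E])
    show "subgroup (E A) circle_group" for A
      unfolding E_def by (rule subgroup_cis_rat_span)
    show "E A \<subseteq> E B" if "A \<subseteq> B" for A B
      unfolding E_def using that by (intro image_mono rat_real.span_mono) blast
    show "y \<in> E A" if y: "y \<in> carrier circle_group" "n > 0" "y [^]\<^bsub>circle_group\<^esub> n \<in> E A"
      for A y and n :: nat
    proof -
      \<comment> \<open>Every point of the circle is cis (2 pi r) for some real r, here
        \<open>Arg y / (2 * pi)\<close>, so closure under roots can be checked on r.\<close>
      have "cis (Arg y) = y"
        using y(1) cis_Arg[of y] by (cases "y = 0") (auto simp: sgn_eq)
      then have *: "y = cis (2 * pi * (Arg y / (2 * pi)))" by simp
      then have "Arg y / (2 * pi) \<in> rat_real.span (insert 1 (\<iota> ` A))"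
        using y(2,3) by (intro E_root[of n]) auto
      with * show ?thesis unfolding E_def by blast
    qed
    show "\<exists>y\<in>E (insert x A). \<forall>n::nat. n > 0 \<longrightarrow> y [^]\<^bsub>circle_group\<^esub> n \<notin> E A"
      if "A \<subseteq> carrier G" "x \<in> carrier G" "x \<notin> A" for A x
    \<comment> \<open>A positive power of this point in \<open>E A\<close> would force
      \<open>\<iota> x\<close> into the span of 1 and the reals attached to \<open>A\<close>,
      against independence.\<close>
    proof (intro bexI[of _ "cis (2 * pi * \<iota> x)"] allI impI)
      show "cis (2 * pi * \<iota> x) [^]\<^bsub>circle_group\<^esub> n \<notin> E A" if "n > 0" for n :: nat
        using E_root[OF that, of "\<iota> x" A] \<iota>[OF \<open>A \<subseteq> carrier G\<close> \<open>x \<in> carrier G\<close> \<open>x \<notin> A\<close>] by auto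
      show "cis (2 * pi * \<iota> x) \<in> E (insert x A)"
        unfolding E_def by (intro imageI rat_real.span_base) simp
    qed
    show "card {y \<in> carrier circle_group. y [^]\<^bsub>circle_group\<^esub> p = w} = p"
      if "prime p" "w \<in> carrier circle_group" for p w
    proof -
      have p: "p > 0" using that(1) by (rule prime_gt_0_nat)
      \<comment> \<open>All complex p-th roots of \<open>w\<close> lie on the circle, so the usual
        count of \<open>p\<close> roots of a nonzero number applies.\<close>
      have "cmod y = 1" if "y ^ p = w" for y
      proof -
        have "cmod y ^ p = 1"
          using that \<open>w \<in> carrier circle_group\<close> by (simp flip: norm_power)
        then show ?thesis using p power_eq_imp_eq_base[of "cmod y" p 1] by simp
      qed
      then have "{y \<in> carrier circle_group. y [^]\<^bsub>circle_group\<^esub> p = w} = {y. y ^ p = w}"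
        by auto
      moreover have "w \<noteq> 0" using that(2) by auto
      ultimately show ?thesis using card_nth_roots[of w p] p by simp
    qed
    show "card S \<le> p" if "prime p" "S \<subseteq> {t \<in> carrier G. t [^]\<^bsub>G\<^esub> p = \<one>\<^bsub>G\<^esub>}" for p S
      using card_torsion_le[OF that(1) no[OF that(1)] that(2)] .
  qed
  then have "faithful_unitary_character G h"
    by (simp add: faithful_unitary_character_def unitary_character_def)
  then show ?thesis by (rule that)
qed

theorem proposition1p12:
  fixes G :: "('a, 'b) monoid_scheme"
  assumes "comm_group G"
  shows "((\<exists>\<chi>. faithful_unitary_character G \<chi>) \<longleftrightarrow> has_subgroup_iso_to circle_group G) \<and>
         ((\<exists>\<chi>. faithful_unitary_character G \<chi>) \<longleftrightarrow>
           carrier G \<lesssim> (UNIV :: real set) \<and>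
           \<not> (\<exists>p::nat. prime p \<and>
               has_subgroup_iso_to G (integer_mod_group p \<times>\<times> integer_mod_group p)))"
proof (intro conjI iffI)
  interpret comm_group G by fact
  \<comment> \<open>The three goals that start from a faithful character share this block: its image
    is the required subgroup, the circle bounds the cardinality, and a copy of C_p x C_p in
    \<open>G\<close> would be carried injectively into the circle.\<close>
  {
    assume "\<exists>\<chi>. faithful_unitary_character G \<chi>"
    then obtain \<chi> where hom: "\<chi> \<in> hom G circle_group" and inj: "inj_on \<chi> (carrier G)"
      by (auto simp: faithful_unitary_character_def unitary_character_def)
    interpret \<chi>: group_hom G circle_group \<chi>
      using hom by (simp add: group_hom_def group_hom_axioms_def circle.is_group is_group)
    show "has_subgroup_iso_to circle_group G"
      using inj by (rule \<chi>.has_subgroup_iso_toI)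
    have "carrier G \<lesssim> carrier circle_group"
      unfolding lepoll_def using inj \<chi>.hom_closed by blast
    also note circle_group_lepoll_real
    finally show "carrier G \<lesssim> (UNIV :: real set)" .
    show "\<not> (\<exists>p::nat. prime p \<and>
        has_subgroup_iso_to G (integer_mod_group p \<times>\<times> integer_mod_group p))"
    proof clarify
      fix p :: nat
      let ?C = "integer_mod_group p \<times>\<times> integer_mod_group p"
      assume p: "prime p" and "has_subgroup_iso_to G ?C"
      then obtain f where f: "f \<in> hom ?C G" "inj_on f (carrier ?C)"
        using has_subgroup_iso_toD[OF is_group] by blast
      have "f ` carrier ?C \<subseteq> carrier G" using f(1) by (auto simp: hom_def)
      then have "inj_on (\<chi> \<circ> f) (carrier ?C)"
        using f(2) inj by (intro comp_inj_on) (auto intro: inj_on_subset)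
      then show False
        using circle_group_no_square_of_cyclic[OF p] Group.hom_compose[OF f(1) hom] by blast
    qed
  }
  \<comment> \<open>The inverse of the isomorphism from the subgroup of the circle onto
    \<open>G\<close> is the character.\<close>
  show "\<exists>\<chi>. faithful_unitary_character G \<chi>" if "has_subgroup_iso_to circle_group G"
    using has_subgroup_iso_toD[OF circle.is_group that]
    by (metis faithful_unitary_character_def unitary_character_def)
  show "\<exists>\<chi>. faithful_unitary_character G \<chi>"
    if "carrier G \<lesssim> (UNIV :: real set) \<and> \<not> (\<exists>p::nat. prime p \<and>
        has_subgroup_iso_to G (integer_mod_group p \<times>\<times> integer_mod_group p))"
    using exists_faithful_unitary_character[OF assms] that by metis
qed

end
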